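(* Let $q_0\in\mathbb{C}\setminus\{0\}$. If there exists either an effective edge interaction $y\in\mathcal{E}(q_0)$ or a virtual interaction $y\in f_{q_0}(\mathcal{E}(q_0))$ such that $|y|>1$, then there exist $q$ arbitrarily close to $q_0$ and $G\in\mathcal{G}_{\mathrm{SP}}$ such that $Z(G;q)=0$.
   Context: The chromatic polynomial of a finite graph $G=(V,E)$ (multiple edges allowed) is $Z(G;q)=\sum_{F\subseteq E}(-1)^{|F|}q^{k(F)}$, where $k(F)$ is the number of connected components of the graph $(V,F)$. A two-terminal graph is a graph with a designated start vertex $s$ and end vertex $t$. For two-terminal graphs $G_1,G_2$ with terminals $s_1,t_1$ and $s_2,t_2$: the parallel composition $G_1\parallel G_2$ is obtained from the disjoint union by identifying $s_1$ with $s_2$ into a single vertex $s$ and $t_1$ with $t_2$ into a single vertex $t$; the series composition $G_1\bowtie G_2$ is obtained from the disjoint union by identifying $t_1$ with $s_2$, with start vertex $s_1$ and end vertex $t_2$. A two-terminal graph is series-parallel if it can be obtained from a single edge $K_2$ using series and parallel compositions; $\mathcal{G}_{\mathrm{SP}}$ denotes the collection of all series-parallel graphs. For a two-terminal graph $G$ put $Z^{\mathrm{dif}}(G;q):=Z(G\parallel K_2;q)$ and $Z^{\mathrm{same}}(G;q):=Z(G;q)-Z^{\mathrm{dif}}(G;q)$ (for positive integers $q$ these count the proper $q$-colorings of $G$ in which $s,t$ get distinct, respectively equal, colors). The ratio is the rational function $R(G;q):=Z^{\mathrm{same}}(G;q)/Z^{\mathrm{dif}}(G;q)$ in $q$, and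 the effective edge interaction of $G$ is the rational function $y_G(q):=(q-1)R(G;q)$. For $q_0\in\mathbb{C}$ set $\mathcal{E}(q_0):=\{y_G(q_0)\mid G\in\mathcal{G}_{\mathrm{SP}}\}$, the set of values at $q_0$ of the effective edge interactions of series-parallel graphs, as a subset of the Riemann sphere $\hat{\mathbb{C}}=\mathbb{C}\cup\{\infty\}$. For $q\neq0$ let $f_q$ be the Möbius transformation $f_q(y)=1+\frac{q}{y-1}$. Elements of $f_q(\mathcal{E}(q))$ are called virtual interactions. *)

theory Defs
  imports
    "HOL-Analysis.Analysis"
    "HOL-Library.Uprod"
    "HOL-Computational_Algebra.Computational_Algebra"
    "HOL-Computational_Algebra.Field_as_Ring"
begin

section \<open>Multigraphs and the chromatic polynomial\<close>

text \<open>
  Undirected multigraphs: edges are abstract names, each carrying an unordered pair of end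
  vertices, so parallel edges (and loops) are possible. Only finite graphs whose edges end in
  \<open>verts\<close> are meaningful.
\<close>

record ('v, 'e) mgraph =
  verts :: "'v set"
  edges :: "'e set"
  ends :: "'e \<Rightarrow> 'v uprod"

definition joined :: "('v, 'e, 'm) mgraph_scheme \<Rightarrow> 'e set \<Rightarrow> ('v \<times> 'v) set" where
  "joined G F = {(u, v). \<exists>e\<in>F. ends G e = Upair u v}"

definition connected_by :: "('v, 'e, 'm) mgraph_scheme \<Rightarrow> 'e set \<Rightarrow> ('v \<times> 'v) set" where
  "connected_by G F = {(u, v) \<in> verts G \<times> verts G. (u, v) \<in> (joined G F)\<^sup>*}"

definition num_components :: "('v, 'e, 'm) mgraph_scheme \<Rightarrow> 'e set \<Rightarrow> nat" where
  "num_components G F = card (verts G // connected_by G F)"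

definition chrom_poly :: "('v, 'e, 'm) mgraph_scheme \<Rightarrow> complex poly" where
  "chrom_poly G = (\<Sum>F\<in>Pow (edges G). monom ((-1) ^ card F) (num_components G F))"


section \<open>Two-terminal graphs\<close>

record ('v, 'e) ttgraph = "('v, 'e) mgraph" +
  start :: 'v
  finish :: 'v

definition edge_graph :: "(nat, nat) ttgraph" where
  "edge_graph = \<lparr>verts = {0, 1}, edges = {0}, ends = (\<lambda>_. Upair 0 1), start = 0, finish = 1\<rparr>"

text \<open>
  Glueing: the vertices of the disjoint union are sent through a map \<open>h\<close> whose fibres are the
  classes of identified vertices.
\<close>

definition glue ::
  "('v + 'w \<Rightarrow> 'x) \<Rightarrow> ('v, 'e) ttgraph \<Rightarrow> ('w, 'f) ttgraph \<Rightarrow> 'x \<Rightarrow> 'x \<Rightarrow> ('x, 'e + 'f) ttgraph"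
  where
  "glue h G1 G2 s t =
    \<lparr>verts = h ` (verts G1 <+> verts G2),
     edges = edges G1 <+> edges G2,
     ends = case_sum (\<lambda>e. map_uprod (h \<circ> Inl) (ends G1 e)) (\<lambda>e. map_uprod (h \<circ> Inr) (ends G2 e)),
     start = s, finish = t\<rparr>"

definition merge :: "'a \<Rightarrow> 'a \<Rightarrow> 'a \<Rightarrow> 'a" where
  "merge a b x = (if x = b then a else x)"

text \<open>
  The second merge in \<open>par_map\<close> is applied to the images under the first one, so that the
  result is the quotient by both identifications even if some terminals coincide.
\<close>

definition par_map :: "('v, 'e) ttgraph \<Rightarrow> ('w, 'f) ttgraph \<Rightarrow> 'v + 'w \<Rightarrow> 'v + 'w" where
  "par_map G1 G2 =
    (let h = merge (Inl (start G1)) (Inr (start G2))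
     in merge (h (Inl (finish G1))) (h (Inr (finish G2))) \<circ> h)"

definition parallel_comp ::
  "('v, 'e) ttgraph \<Rightarrow> ('w, 'f) ttgraph \<Rightarrow> ('v + 'w, 'e + 'f) ttgraph" where
  "parallel_comp G1 G2 =
    (let h = par_map G1 G2 in glue h G1 G2 (h (Inl (start G1))) (h (Inl (finish G1))))"

definition series_comp ::
  "('v, 'e) ttgraph \<Rightarrow> ('w, 'f) ttgraph \<Rightarrow> ('v + 'w, 'e + 'f) ttgraph" where
  "series_comp G1 G2 =
    (let h = merge (Inl (finish G1)) (Inr (start G2))
     in glue h G1 G2 (h (Inl (start G1))) (h (Inr (finish G2))))"

definition tt_iso :: "('v, 'e) ttgraph \<Rightarrow> ('w, 'f) ttgraph \<Rightarrow> bool" where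
  "tt_iso G H \<longleftrightarrow>
    (\<exists>f g. bij_betw f (verts G) (verts H) \<and> bij_betw g (edges G) (edges H) \<and>
      (\<forall>e\<in>edges G. ends H (g e) = map_uprod f (ends G e)) \<and>
      f (start G) = start H \<and> f (finish G) = finish H)"

text \<open>
  Series-parallel graphs are represented, up to isomorphism, on subsets of the naturals; the
  compositions change the vertex and edge types, hence the renaming in each rule.
\<close>

inductive_set series_parallel :: "(nat, nat) ttgraph set" where
  edge: "tt_iso edge_graph G \<Longrightarrow> G \<in> series_parallel"
| parallel: "\<lbrakk>G1 \<in> series_parallel; G2 \<in> series_parallel; tt_iso (parallel_comp G1 G2) G\<rbrakk>
    \<Longrightarrow> G \<in> series_parallel"
| series: "\<lbrakk>G1 \<in> series_parallel; G2 \<in> series_parallel; tt_iso (series_comp G1 G2) G\<rbrakk>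
    \<Longrightarrow> G \<in> series_parallel"


section \<open>Effective edge interactions and virtual interactions\<close>

definition Z_dif :: "('v, 'e) ttgraph \<Rightarrow> complex poly" where
  "Z_dif G = chrom_poly (parallel_comp G edge_graph)"

definition Z_same :: "('v, 'e) ttgraph \<Rightarrow> complex poly" where
  "Z_same G = chrom_poly G - Z_dif G"

definition ratio :: "('v, 'e) ttgraph \<Rightarrow> complex poly fract" where
  "ratio G = to_fract (Z_same G) / to_fract (Z_dif G)"

definition edge_interaction :: "('v, 'e) ttgraph \<Rightarrow> complex poly fract" where
  "edge_interaction G = to_fract [:-1, 1:] * ratio G"

text \<open>
  The Riemann sphere, with \<open>None\<close> as the point at infinity (the carrier of
  \<open>Alexandroff_compactification euclidean\<close>).
\<close>

type_synonym riemann_sphere = "complex option"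

fun sphere_abs :: "riemann_sphere \<Rightarrow> ereal" where
  "sphere_abs None = \<infinity>"
| "sphere_abs (Some z) = ereal (cmod z)"

text \<open>
  \<open>quot_of_fract\<close> yields numerator and denominator in lowest terms, so removable singularities
  are removed and a zero of the denominator is a genuine pole.
\<close>

definition rat_value :: "complex poly fract \<Rightarrow> complex \<Rightarrow> riemann_sphere" where
  "rat_value r q =
    (let (a, b) = quot_of_fract r
     in if poly b q = 0 then None else Some (poly a q / poly b q))"

definition edge_interactions :: "complex \<Rightarrow> riemann_sphere set" where
  "edge_interactions q = {rat_value (edge_interaction G) q | G. G \<in> series_parallel}"

text \<open>The Moebius transformation \<open>y \<mapsto> 1 + q / (y - 1)\<close> on the sphere, for \<open>q \<noteq> 0\<close>.\<close>

fun moebius_f :: "complex \<Rightarrow> riemann_sphere \<Rightarrow> riemann_sphere" where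
  "moebius_f q None = Some 1"
| "moebius_f q (Some y) = (if y = 1 then None else Some (1 + q / (y - 1)))"

definition virtual_interactions :: "complex \<Rightarrow> riemann_sphere set" where
  "virtual_interactions q = moebius_f q ` edge_interactions q"

end

theory Submission
  imports Defs "HOL-Complex_Analysis.Conformal_Mappings"
begin

text \<open>
  Write \<open>y\<^sub>G = a / b\<close> and \<open>v\<^sub>G = f\<^sub>q(y\<^sub>G) = (a + (q - 1) b) / (a - b)\<close>, where \<open>a\<close> and \<open>b\<close> count colourings
  extending equal, respectively different, colours of the terminals. Interactions multiply under
  parallel composition, virtual interactions under series composition, and each is the image of the
  other under the involution \<open>f\<^sub>q\<close>. Moreover \<open>Z = q (a + (q - 1) b)\<close>, and composing with a parallel
  edge shows that a zero of \<open>b\<close> is a chromatic zero of a series-parallel graph as well.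

  Assume that no such zero lies in a disc \<open>U\<close> around \<open>q\<^sub>0\<close>. Then all \<open>y\<^sub>G\<close> and all \<open>1 / v\<^sub>G\<close> are
  holomorphic on \<open>U\<close>, and the theorem follows from three observations in place of a normality
  argument.

  \<^item> \<open>\<bar>v\<^sub>G\<bar> = 1\<close> is impossible on \<open>U\<close>: by the open mapping theorem \<open>v\<^sub>G\<close> would be a root of unity at some
    point, and a series power of \<open>G\<close> would have \<open>b = 0\<close> there
    (\<open>virtual_interaction_not_unimodular\<close>). Hence \<open>\<bar>v\<^sub>G\<bar> - 1\<close> has constant sign on \<open>U\<close>.

  \<^item> \<open>\<bar>y\<^sub>G\<bar> > 1\<close> is impossible on \<open>U\<close>: the powers \<open>y\<^sub>G\<^sup>n\<close> tend to infinity while their arguments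
    rotate, so that \<open>f\<^sub>q(y\<^sub>G\<^sup>n)\<close> lies close to 1, inside the unit circle at one point and outside
    at another (\<open>powers_surround_bisector\<close>, \<open>edge_interaction_le_1\<close>).

  \<^item> \<open>\<bar>v\<^sub>G\<bar> > 1\<close> is impossible on \<open>U\<close>: by the same rotation \<open>\<bar>f\<^sub>q(v\<^sub>G\<^sup>n)\<bar> > 1\<close> at some point, and
    this is an interaction of modulus greater than 1 (\<open>virtual_interaction_le_1\<close>).

  The open mapping theorem needs non-constant functions. For real \<open>q < 0\<close> all interactions lie in
  \<open>[0, 1)\<close> and all virtual interactions are at least \<open>1 - q\<close> (\<open>interaction_polys_negative\<close>), which
  excludes constants of modulus greater than 1 for the former and all constants for the latter.

  The recursion for \<open>a\<close> and \<open>b\<close> is obtained from counting proper colourings, which determines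
  \<open>Z\<close> because a polynomial is determined by its values at the natural numbers.
\<close>

section \<open>The chromatic polynomial counts proper colourings\<close>

definition monochromatic :: "('v \<Rightarrow> 'c) \<Rightarrow> 'v uprod \<Rightarrow> bool" where
  "monochromatic c p \<longleftrightarrow> (\<exists>x. map_uprod c p = Upair x x)"

lemma monochromatic_Upair [simp]: "monochromatic c (Upair u v) \<longleftrightarrow> c u = c v"
  by (auto simp: monochromatic_def)

lemma monochromatic_map_uprod [simp]:
  "monochromatic c (map_uprod h p) \<longleftrightarrow> monochromatic (c \<circ> h) p"
  by (cases p) simp

lemma monochromatic_cong:
  "(\<And>x. x \<in> set_uprod p \<Longrightarrow> c x = d x) \<Longrightarrow> monochromatic c p \<longleftrightarrow> monochromatic d p"
  by (cases p) simp

definition fin_mgraph :: "('v, 'e, 'm) mgraph_scheme \<Rightarrow> bool" where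
  "fin_mgraph G \<longleftrightarrow> finite (verts G) \<and> finite (edges G) \<and>
     (\<forall>e\<in>edges G. set_uprod (ends G e) \<subseteq> verts G)"

definition colourings :: "('v, 'e, 'm) mgraph_scheme \<Rightarrow> nat \<Rightarrow> ('v \<Rightarrow> nat) set" where
  "colourings G q =
    {c \<in> verts G \<rightarrow>\<^sub>E {..<q}. \<forall>e\<in>edges G. \<not> monochromatic c (ends G e)}"

lemma bij_betw_Collect_iff:
  assumes "bij_betw f A B" and "\<And>a. a \<in> A \<Longrightarrow> P a \<longleftrightarrow> Q (f a)"
  shows "bij_betw f {a \<in> A. P a} {b \<in> B. Q b}"
proof -
  have "f ` {a \<in> A. P a} = {b \<in> B. Q b}"
    using assms bij_betw_imp_surj_on[OF assms(1)] by auto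
  moreover have "inj_on f {a \<in> A. P a}"
    using bij_betw_imp_inj_on[OF assms(1)] by (rule inj_on_subset) auto
  ultimately show ?thesis by (simp add: bij_betw_def)
qed

text \<open>
  Functions on a quotient are the functions on \<open>V\<close> that are constant on the fibres of the quotient
  map. Three counts below are instances: colourings constant on components, colourings of an
  isomorphic graph, and colourings of a glued graph.
\<close>

lemma bij_betw_pullback:
  "bij_betw (\<lambda>c. restrict (c \<circ> f) V) (f ` V \<rightarrow>\<^sub>E Q)
     {d \<in> V \<rightarrow>\<^sub>E Q. \<forall>x\<in>V. \<forall>y\<in>V. f x = f y \<longrightarrow> d x = d y}"
  (is "bij_betw ?p ?A ?B")
proof (rule bij_betw_byWitness[where f' = "\<lambda>d. \<lambda>w\<in>f ` V. d (inv_into V f w)"])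
  show "\<forall>c\<in>?A. (\<lambda>w\<in>f ` V. ?p c (inv_into V f w)) = c"
  proof
    fix c assume c: "c \<in> ?A"
    show "(\<lambda>w\<in>f ` V. ?p c (inv_into V f w)) = c"
    proof
      fix w show "(\<lambda>w\<in>f ` V. ?p c (inv_into V f w)) w = c w"
        using PiE_arb[OF c, of w]
        by (cases "w \<in> f ` V") (simp_all add: inv_into_into f_inv_into_f)
    qed
  qed
  show "\<forall>d\<in>?B. ?p (\<lambda>w\<in>f ` V. d (inv_into V f w)) = d"
  proof
    fix d assume d: "d \<in> ?B"
    then have dE: "d \<in> V \<rightarrow>\<^sub>E Q" by simp
    show "?p (\<lambda>w\<in>f ` V. d (inv_into V f w)) = d"
    proof
      fix x
      have "d (inv_into V f (f x)) = d x" if "x \<in> V"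
        using d that f_inv_into_f[of "f x" f V] inv_into_into[of "f x" f V] by blast
      then show "?p (\<lambda>w\<in>f ` V. d (inv_into V f w)) x = d x"
        using PiE_arb[of d V "\<lambda>_. Q" x] dE by (cases "x \<in> V") auto
    qed
  qed
  show "?p ` ?A \<subseteq> ?B"
    by auto
  show "(\<lambda>d. \<lambda>w\<in>f ` V. d (inv_into V f w)) ` ?B \<subseteq> ?A"
  proof (rule image_subsetI)
    fix d assume "d \<in> ?B"
    then have "d \<in> V \<rightarrow>\<^sub>E Q" by simp
    then show "(\<lambda>w\<in>f ` V. d (inv_into V f w)) \<in> ?A"
      using PiE_mem[of d V "\<lambda>_. Q"] inv_into_into[of _ f V] by simp
  qed
qed

lemma Upair_commute: "Upair u v = Upair v u"
  by simp

lemma equiv_connected_by: "equiv (verts G) (connected_by G F)"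
proof (rule equivI)
  have "sym (joined G F)"
    unfolding joined_def sym_def by (simp add: Upair_commute)
  then have "sym ((joined G F)\<^sup>*)" by (rule sym_rtrancl)
  then show "sym (connected_by G F)"
    unfolding connected_by_def sym_def by auto
qed (auto simp: connected_by_def refl_on_def trans_def)

text \<open>
  Being constant on the edges of \<open>F\<close> means being constant on the components of \<open>(V, F)\<close>, so such
  a colouring is a free choice of a colour for each component.
\<close>

lemma card_constant_on_components:
  assumes "fin_mgraph G" "F \<subseteq> edges G"
  shows "card {c \<in> verts G \<rightarrow>\<^sub>E {..<q}. \<forall>e\<in>F. monochromatic c (ends G e)}
       = q ^ num_components G F"
proof -
  define R where "R = connected_by G F"
  define f where "f = (\<lambda>x. R `` {x})"
  have fin: "finite (verts G)" using assms by (simp add: fin_mgraph_def)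
  have eqv: "equiv (verts G) R" unfolding R_def by (rule equiv_connected_by)
  have quot: "f ` verts G = verts G // R" by (auto simp: f_def quotient_def)
  have f_eq: "f x = f y \<longleftrightarrow> (x, y) \<in> R" if "x \<in> verts G" "y \<in> verts G" for x y
    using eq_equiv_class_iff[OF eqv that] by (simp add: f_def)
  have respects: "(\<forall>x\<in>verts G. \<forall>y\<in>verts G. f x = f y \<longrightarrow> c x = c y) \<longleftrightarrow>
      (\<forall>e\<in>F. monochromatic c (ends G e))" for c :: "'a \<Rightarrow> nat"
  proof
    assume *: "\<forall>x\<in>verts G. \<forall>y\<in>verts G. f x = f y \<longrightarrow> c x = c y"
    show "\<forall>e\<in>F. monochromatic c (ends G e)"
    proof
      fix e assume e: "e \<in> F"
      obtain u v where uv: "ends G e = Upair u v" by (cases "ends G e") auto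
      have "set_uprod (ends G e) \<subseteq> verts G" using assms e by (auto simp: fin_mgraph_def)
      then have V: "u \<in> verts G" "v \<in> verts G" using uv by auto
      have "(u, v) \<in> joined G F" using e uv by (auto simp: joined_def)
      then have "(u, v) \<in> R" using V by (auto simp: R_def connected_by_def)
      then show "monochromatic c (ends G e)" using * V f_eq uv by auto
    qed
  next
    assume *: "\<forall>e\<in>F. monochromatic c (ends G e)"
    have "c x = c y" if "(x, y) \<in> (joined G F)\<^sup>*" for x y
      using that
    proof induction
      case (step y z)
      then obtain e where "e \<in> F" "ends G e = Upair y z" by (auto simp: joined_def)
      then show ?case using * step.IH by (metis monochromatic_Upair)
    qed simp
    then show "\<forall>x\<in>verts G. \<forall>y\<in>verts G. f x = f y \<longrightarrow> c x = c y"
      using f_eq by (auto simp: R_def connected_by_def)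
  qed
  have "card (f ` verts G \<rightarrow>\<^sub>E {..<q})
      = card {c \<in> verts G \<rightarrow>\<^sub>E {..<q}. \<forall>x\<in>verts G. \<forall>y\<in>verts G. f x = f y \<longrightarrow> c x = c y}"
    by (rule bij_betw_same_card[OF bij_betw_pullback])
  then show ?thesis
    using fin by (simp add: respects quot[symmetric] card_funcsetE num_components_def R_def[symmetric])
qed

text \<open>
  Inclusion-exclusion over the monochromatic edges: expand \<open>\<Prod>\<^sub>e (1 - [e is monochromatic])\<close>, the
  indicator of a proper colouring, and sum over all colourings.
\<close>

lemma poly_chrom_poly_of_nat:
  assumes "fin_mgraph G"
  shows "poly (chrom_poly G) (of_nat q) = of_nat (card (colourings G q))"
proof -
  have fin: "finite (verts G)" "finite (edges G)" using assms by (auto simp: fin_mgraph_def)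
  let ?C = "verts G \<rightarrow>\<^sub>E {..<q}"
  have finC: "finite ?C" using fin by (simp add: finite_PiE)
  let ?m = "\<lambda>c e. if monochromatic c (ends G e) then 1 else (0::complex)"
  have prod: "(\<Prod>e\<in>F. ?m c e) = (if \<forall>e\<in>F. monochromatic c (ends G e) then 1 else 0)"
    if "F \<subseteq> edges G" for F c
    using finite_subset[OF that fin(2)] by (induction F rule: finite_induct) auto
  have proper: "(\<Prod>e\<in>edges G. 1 - ?m c e) = (if c \<in> colourings G q then 1 else 0)"
    if "c \<in> ?C" for c
  proof -
    have "(\<Prod>e\<in>F. 1 - ?m c e) = (if \<forall>e\<in>F. \<not> monochromatic c (ends G e) then 1 else 0)"
      if "F \<subseteq> edges G" for F
      using finite_subset[OF that fin(2)] by (induction F rule: finite_induct) auto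
    from this[of "edges G"] show ?thesis using \<open>c \<in> ?C\<close> by (simp add: colourings_def)
  qed
  have "poly (chrom_poly G) (of_nat q)
      = (\<Sum>F\<in>Pow (edges G). (-1) ^ card F * of_nat (q ^ num_components G F))"
    by (simp add: chrom_poly_def poly_sum poly_monom)
  also have "\<dots> = (\<Sum>F\<in>Pow (edges G). (-1) ^ card F * (\<Sum>c\<in>?C. \<Prod>e\<in>F. ?m c e))"
  proof (rule sum.cong[OF refl])
    fix F assume "F \<in> Pow (edges G)"
    then have F: "F \<subseteq> edges G" by simp
    have "(\<Sum>c\<in>?C. \<Prod>e\<in>F. ?m c e)
        = of_nat (card {c \<in> ?C. \<forall>e\<in>F. monochromatic c (ends G e)})"
      unfolding prod[OF F] using finC by (simp add: sum.If_cases Int_def)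
    also have "\<dots> = of_nat (q ^ num_components G F)"
      by (simp only: card_constant_on_components[OF assms F])
    finally show "(-1) ^ card F * of_nat (q ^ num_components G F)
        = (-1) ^ card F * (\<Sum>c\<in>?C. \<Prod>e\<in>F. ?m c e)" by simp
  qed
  also have "\<dots> = (\<Sum>c\<in>?C. \<Sum>F\<in>Pow (edges G). (-1) ^ card F * (\<Prod>e\<in>F. ?m c e))"
    by (simp only: sum_distrib_left) (rule sum.swap)
  also have "\<dots> = (\<Sum>c\<in>?C. \<Prod>e\<in>edges G. 1 - ?m c e)"
    by (subst prod_diff_conv_sum[OF fin(2)]) simp
  also have "\<dots> = (\<Sum>c\<in>?C. if c \<in> colourings G q then 1 else 0)"
    using proper by (intro sum.cong) auto
  also have "\<dots> = of_nat (card (?C \<inter> colourings G q))"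
    using finC by (simp add: sum.If_cases)
  also have "?C \<inter> colourings G q = colourings G q" by (auto simp: colourings_def)
  finally show ?thesis .
qed

section \<open>Colourings with prescribed terminal colours\<close>

definition fin_ttgraph :: "('v, 'e) ttgraph \<Rightarrow> bool" where
  "fin_ttgraph G \<longleftrightarrow> fin_mgraph G \<and> start G \<in> verts G \<and> finish G \<in> verts G \<and> start G \<noteq> finish G"

definition terminal_colourings :: "('v, 'e) ttgraph \<Rightarrow> nat \<Rightarrow> nat \<Rightarrow> nat \<Rightarrow> ('v \<Rightarrow> nat) set" where
  "terminal_colourings G q i j = {c \<in> colourings G q. c (start G) = i \<and> c (finish G) = j}"

lemma finite_colourings: "fin_mgraph G \<Longrightarrow> finite (colourings G q)"
  unfolding colourings_def fin_mgraph_def by (rule finite_Collect_conjI) (simp add: finite_PiE)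

lemma set_uprod_map_uprod [simp]: "set_uprod (map_uprod f p) = f ` set_uprod p"
  by (cases p) simp

lemma fin_ttgraph_iso:
  assumes "tt_iso G H" "fin_ttgraph G"
  shows "fin_ttgraph H"
proof -
  obtain f g where f: "bij_betw f (verts G) (verts H)" and g: "bij_betw g (edges G) (edges H)"
    and ends: "\<forall>e\<in>edges G. ends H (g e) = map_uprod f (ends G e)"
    and st: "f (start G) = start H" "f (finish G) = finish H"
    using assms(1) by (auto simp: tt_iso_def)
  have "set_uprod (ends H e) \<subseteq> verts H" if "e \<in> edges H" for e
  proof -
    obtain e' where "e' \<in> edges G" "e = g e'" using \<open>e \<in> edges H\<close> g by (auto simp: bij_betw_def)
    moreover from this have "set_uprod (ends G e') \<subseteq> verts G"
      using assms(2) by (simp add: fin_ttgraph_def fin_mgraph_def)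
    ultimately show ?thesis
      using ends bij_betw_imp_surj_on[OF f] by auto
  qed
  then have "fin_mgraph H"
    using assms(2) bij_betw_finite[OF f] bij_betw_finite[OF g]
    unfolding fin_ttgraph_def fin_mgraph_def by blast
  moreover have "f (start G) \<in> verts H" "f (finish G) \<in> verts H" "f (start G) \<noteq> f (finish G)"
    using assms(2) bij_betw_apply[OF f] inj_on_eq_iff[OF bij_betw_imp_inj_on[OF f]]
    unfolding fin_ttgraph_def by blast+
  ultimately show ?thesis
    unfolding fin_ttgraph_def st by blast
qed

lemma card_terminal_colourings_iso:
  assumes "tt_iso G H" "fin_ttgraph G"
  shows "card (terminal_colourings H q i j) = card (terminal_colourings G q i j)"
proof -
  obtain f g where f: "bij_betw f (verts G) (verts H)" and g: "bij_betw g (edges G) (edges H)"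
    and ends: "\<forall>e\<in>edges G. ends H (g e) = map_uprod f (ends G e)"
    and st: "f (start G) = start H" "f (finish G) = finish H"
    using assms(1) by (auto simp: tt_iso_def)
  have vH: "f ` verts G = verts H" and eH: "edges H = g ` edges G"
    using f g by (auto simp: bij_betw_def)
  have inj: "(\<forall>x\<in>verts G. \<forall>y\<in>verts G. f x = f y \<longrightarrow> d x = d y)" for d :: "'a \<Rightarrow> nat"
    using f by (auto simp: bij_betw_def inj_on_def)
  have mono: "monochromatic (restrict (c \<circ> f) (verts G)) (ends G e) \<longleftrightarrow> monochromatic c (ends H (g e))"
    if "e \<in> edges G" for c :: "'c \<Rightarrow> nat" and e
  proof -
    have "monochromatic (restrict (c \<circ> f) (verts G)) (ends G e) \<longleftrightarrow> monochromatic (c \<circ> f) (ends G e)"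
      using that assms(2) by (intro monochromatic_cong) (auto simp: fin_ttgraph_def fin_mgraph_def)
    then show ?thesis using ends that by simp
  qed
  have H: "terminal_colourings H q i j = {c \<in> f ` verts G \<rightarrow>\<^sub>E {..<q}.
      (\<forall>e\<in>edges H. \<not> monochromatic c (ends H e)) \<and> c (start H) = i \<and> c (finish H) = j}"
    unfolding terminal_colourings_def colourings_def vH by blast
  have bij: "bij_betw (\<lambda>c. restrict (c \<circ> f) (verts G)) \<dots>
     {d \<in> {d \<in> verts G \<rightarrow>\<^sub>E {..<q}. \<forall>x\<in>verts G. \<forall>y\<in>verts G. f x = f y \<longrightarrow> d x = d y}.
        (\<forall>e\<in>edges G. \<not> monochromatic d (ends G e)) \<and> d (start G) = i \<and> d (finish G) = j}"
    using assms(2)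
    by (intro bij_betw_Collect_iff[OF bij_betw_pullback]) (simp add: mono eH st fin_ttgraph_def)
  have G: "\<dots> = terminal_colourings G q i j"
    unfolding terminal_colourings_def colourings_def using inj by blast
  show ?thesis
    unfolding H by (rule bij_betw_same_card[OF bij[unfolded G]])
qed

lemma Inl_Inr_in_Plus [simp]:
  "Inl x \<in> A <+> B \<longleftrightarrow> x \<in> A" "Inr y \<in> A <+> B \<longleftrightarrow> y \<in> B"
  by auto

text \<open>
  A colouring of a glued graph is a pair of colourings of the parts that agree on identified
  vertices. The glueing map is left general so that both compositions are instances; what is left
  for them is to say which vertices are identified.
\<close>

lemma card_terminal_colourings_glue:
  fixes G1 :: "('v, 'e) ttgraph" and G2 :: "('w, 'f) ttgraph" and h :: "'v + 'w \<Rightarrow> 'x"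
  defines "V \<equiv> verts G1 <+> verts G2"
  assumes G: "fin_mgraph G1" "fin_mgraph G2" and xy: "x \<in> V" "y \<in> V"
  shows "card (terminal_colourings (glue h G1 G2 (h x) (h y)) q i j) =
    card {(c1, c2) \<in> colourings G1 q \<times> colourings G2 q.
      (\<forall>u\<in>V. \<forall>v\<in>V. h u = h v \<longrightarrow> case_sum c1 c2 u = case_sum c1 c2 v) \<and>
      case_sum c1 c2 x = i \<and> case_sum c1 c2 y = j}" (is "_ = card ?P")
proof -
  let ?H = "glue h G1 G2 (h x) (h y)"
  define C where "C = (\<lambda>d :: 'v + 'w \<Rightarrow> nat.
     (\<forall>e\<in>edges G1. \<not> monochromatic (d \<circ> Inl) (ends G1 e)) \<and>
     (\<forall>e\<in>edges G2. \<not> monochromatic (d \<circ> Inr) (ends G2 e)) \<and> d x = i \<and> d y = j)"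
  define resp where "resp = (\<lambda>d :: 'v + 'w \<Rightarrow> nat. \<forall>u\<in>V. \<forall>v\<in>V. h u = h v \<longrightarrow> d u = d v)"
  define D where "D = {d \<in> {d \<in> V \<rightarrow>\<^sub>E {..<q}. resp d}. C d}"
  have P: "?P = {p \<in> colourings G1 q \<times> colourings G2 q. resp (case_sum (fst p) (snd p)) \<and>
      case_sum (fst p) (snd p) x = i \<and> case_sum (fst p) (snd p) y = j}"
    unfolding resp_def split_def prod.collapse ..
  have mono1: "monochromatic (restrict (c \<circ> h) V \<circ> Inl) (ends G1 e) \<longleftrightarrow> monochromatic (c \<circ> (h \<circ> Inl)) (ends G1 e)"
    if "e \<in> edges G1" for c :: "'x \<Rightarrow> nat" and e
    using that G by (intro monochromatic_cong) (auto simp: fin_mgraph_def V_def)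
  have mono2: "monochromatic (restrict (c \<circ> h) V \<circ> Inr) (ends G2 e) \<longleftrightarrow> monochromatic (c \<circ> (h \<circ> Inr)) (ends G2 e)"
    if "e \<in> edges G2" for c :: "'x \<Rightarrow> nat" and e
    using that G by (intro monochromatic_cong) (auto simp: fin_mgraph_def V_def)
  \<comment> \<open>The bijection goes through \<open>D\<close>, the colourings of the disjoint union that respect \<open>h\<close>.\<close>
  have H: "terminal_colourings ?H q i j =
      {c \<in> h ` V \<rightarrow>\<^sub>E {..<q}. (\<forall>e\<in>edges ?H. \<not> monochromatic c (ends ?H e)) \<and> c (h x) = i \<and> c (h y) = j}"
    by (auto simp: terminal_colourings_def colourings_def glue_def V_def)
  have bij: "bij_betw (\<lambda>c. restrict (c \<circ> h) V) \<dots> D"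
    unfolding D_def resp_def
  proof (rule bij_betw_Collect_iff[OF bij_betw_pullback])
    fix c :: "'x \<Rightarrow> nat"
    have "(\<forall>e\<in>edges ?H. \<not> monochromatic c (ends ?H e)) \<longleftrightarrow>
       (\<forall>e\<in>edges G1. \<not> monochromatic (c \<circ> (h \<circ> Inl)) (ends G1 e)) \<and>
       (\<forall>e\<in>edges G2. \<not> monochromatic (c \<circ> (h \<circ> Inr)) (ends G2 e))"
      by (auto simp: glue_def Plus_def ball_Un)
    then show "((\<forall>e\<in>edges ?H. \<not> monochromatic c (ends ?H e)) \<and> c (h x) = i \<and> c (h y) = j)
       \<longleftrightarrow> C (restrict (c \<circ> h) V)"
      using xy by (simp add: C_def mono1 mono2)
  qed
  have "card (terminal_colourings ?H q i j) = card D"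
    unfolding H by (rule bij_betw_same_card[OF bij])
  have sur: "case_sum (d \<circ> Inl) (d \<circ> Inr) = d" for d :: "'v + 'w \<Rightarrow> nat"
    by (rule ext) (simp split: sum.split)
  have "bij_betw (\<lambda>d. (d \<circ> Inl, d \<circ> Inr)) D ?P"
    unfolding P
  proof (rule bij_betw_byWitness[where f' = "\<lambda>p. case_sum (fst p) (snd p)"]; intro ballI image_subsetI)
    fix d assume "d \<in> D"
    then have dE: "d \<in> V \<rightarrow>\<^sub>E {..<q}" and d: "C d" "resp d" unfolding D_def by simp_all
    have "d \<circ> Inl \<in> verts G1 \<rightarrow>\<^sub>E {..<q}" "d \<circ> Inr \<in> verts G2 \<rightarrow>\<^sub>E {..<q}"
      using PiE_mem[OF dE, of "Inl _"] PiE_mem[OF dE, of "Inr _"]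
        PiE_arb[OF dE, of "Inl _"] PiE_arb[OF dE, of "Inr _"] by (auto simp: V_def)
    then have "d \<circ> Inl \<in> colourings G1 q" "d \<circ> Inr \<in> colourings G2 q"
      using d by (simp_all add: C_def colourings_def)
    then show "(d \<circ> Inl, d \<circ> Inr) \<in> {p \<in> colourings G1 q \<times> colourings G2 q.
        resp (case_sum (fst p) (snd p)) \<and> case_sum (fst p) (snd p) x = i \<and> case_sum (fst p) (snd p) y = j}"
      using d unfolding mem_Collect_eq fst_conv snd_conv sur mem_Times_iff C_def by blast
  next
    fix p
    assume p: "p \<in> {p \<in> colourings G1 q \<times> colourings G2 q.
        resp (case_sum (fst p) (snd p)) \<and> case_sum (fst p) (snd p) x = i \<and> case_sum (fst p) (snd p) y = j}"
    then have cE: "fst p \<in> verts G1 \<rightarrow>\<^sub>E {..<q}" "snd p \<in> verts G2 \<rightarrow>\<^sub>E {..<q}"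
      by (auto simp: colourings_def)
    have "case_sum (fst p) (snd p) v \<in> {..<q}" if "v \<in> V" for v
      using that PiE_mem[OF cE(1)] PiE_mem[OF cE(2)] by (auto simp: V_def)
    moreover have "case_sum (fst p) (snd p) v = undefined" if "v \<notin> V" for v
      using that PiE_arb[OF cE(1)] PiE_arb[OF cE(2)] by (cases v) (auto simp: V_def)
    ultimately have "case_sum (fst p) (snd p) \<in> V \<rightarrow>\<^sub>E {..<q}" by (rule PiE_I)
    then show "case_sum (fst p) (snd p) \<in> D"
      using p unfolding D_def C_def colourings_def by (simp add: case_sum_o_inj mem_Times_iff)
  qed (simp_all only: fst_conv snd_conv sur case_sum_o_inj prod.collapse)
  then have "card D = card ?P" by (rule bij_betw_same_card)
  with \<open>card (terminal_colourings ?H q i j) = card D\<close> show ?thesis by (rule trans)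
qed

lemma fin_mgraph_glue:
  assumes "fin_mgraph G1" "fin_mgraph G2"
  shows "fin_mgraph (glue h G1 G2 s t)"
proof -
  have "(h \<circ> Inl) ` set_uprod (ends G1 e) \<subseteq> h ` (verts G1 <+> verts G2)" if "e \<in> edges G1" for e
    using assms(1) that by (auto simp: fin_mgraph_def)
  moreover have "(h \<circ> Inr) ` set_uprod (ends G2 e) \<subseteq> h ` (verts G1 <+> verts G2)" if "e \<in> edges G2" for e
    using assms(2) that by (auto simp: fin_mgraph_def)
  ultimately show ?thesis
    using assms unfolding fin_mgraph_def glue_def by (simp add: Plus_def ball_Un del: image_comp)
qed

text \<open>
  With distinct terminals the two identifications of \<open>par_map\<close> do not interfere.
\<close>

lemma par_map_eq:
  assumes "start G2 \<noteq> finish G2"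
  shows "par_map G1 G2 x = (if x = Inr (start G2) then Inl (start G1)
           else if x = Inr (finish G2) then Inl (finish G1) else x)"
  using assms by (auto simp: par_map_def merge_def Let_def)

lemma fin_ttgraph_parallel:
  assumes "fin_ttgraph G1" "fin_ttgraph G2"
  shows "fin_ttgraph (parallel_comp G1 G2)"
proof -
  let ?h = "par_map G1 G2"
  have "fin_mgraph (parallel_comp G1 G2)"
    using assms by (simp add: parallel_comp_def Let_def fin_mgraph_glue fin_ttgraph_def)
  then show ?thesis
    using assms by (auto simp: parallel_comp_def Let_def fin_ttgraph_def par_map_eq glue_def)
qed

lemma fin_ttgraph_series:
  assumes "fin_ttgraph G1" "fin_ttgraph G2"
  shows "fin_ttgraph (series_comp G1 G2)"
proof -
  have "fin_mgraph (series_comp G1 G2)"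
    using assms by (simp add: series_comp_def Let_def fin_mgraph_glue fin_ttgraph_def)
  then show ?thesis
    using assms by (auto simp: series_comp_def Let_def fin_ttgraph_def merge_def glue_def)
qed

lemma card_terminal_colourings_parallel:
  assumes "fin_ttgraph G1" "fin_ttgraph G2"
  shows "card (terminal_colourings (parallel_comp G1 G2) q i j) =
    card (terminal_colourings G1 q i j) * card (terminal_colourings G2 q i j)"
proof -
  let ?h = "par_map G1 G2" and ?V = "verts G1 <+> verts G2"
  have terminals: "start G1 \<in> verts G1" "finish G1 \<in> verts G1" "start G2 \<in> verts G2" "finish G2 \<in> verts G2"
      "start G2 \<noteq> finish G2"
    using assms by (auto simp: fin_ttgraph_def)
  have "(\<forall>u\<in>?V. \<forall>v\<in>?V. ?h u = ?h v \<longrightarrow> case_sum c1 c2 u = case_sum c1 c2 v) \<longleftrightarrow>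
      c1 (start G1) = c2 (start G2) \<and> c1 (finish G1) = c2 (finish G2)" (is "?L c1 c2 \<longleftrightarrow> ?R c1 c2")
    for c1 :: "'a \<Rightarrow> nat" and c2 :: "'c \<Rightarrow> nat"
  proof
    assume L: "?L c1 c2"
    have "?h (Inl (start G1)) = ?h (Inr (start G2))" "?h (Inl (finish G1)) = ?h (Inr (finish G2))"
      using terminals by (simp_all add: par_map_eq)
    then show "?R c1 c2" using L terminals by (metis InlI InrI old.sum.simps(5,6))
  next
    assume R: "?R c1 c2"
    have "case_sum c1 c2 (?h u) = case_sum c1 c2 u" for u
      using R terminals by (simp add: par_map_eq)
    then show "?L c1 c2" by metis
  qed
  then have "{(c1, c2) \<in> colourings G1 q \<times> colourings G2 q.
      ?L c1 c2 \<and> case_sum c1 c2 (Inl (start G1)) = i \<and> case_sum c1 c2 (Inl (finish G1)) = j}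
    = terminal_colourings G1 q i j \<times> terminal_colourings G2 q i j"
    by (auto simp: terminal_colourings_def)
  then show ?thesis
    using assms terminals
    by (simp add: parallel_comp_def Let_def card_terminal_colourings_glue fin_ttgraph_def InlI
        card_cartesian_product)
qed

lemma card_terminal_colourings_series:
  assumes "fin_ttgraph G1" "fin_ttgraph G2"
  shows "card (terminal_colourings (series_comp G1 G2) q i j) =
    (\<Sum>k<q. card (terminal_colourings G1 q i k) * card (terminal_colourings G2 q k j))"
proof -
  let ?h = "merge (Inl (finish G1)) (Inr (start G2)) :: 'a + 'c \<Rightarrow> _" and ?V = "verts G1 <+> verts G2"
  have terminals: "start G1 \<in> verts G1" "finish G1 \<in> verts G1" "start G2 \<in> verts G2" "finish G2 \<in> verts G2"
      "start G2 \<noteq> finish G2"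
    using assms by (auto simp: fin_ttgraph_def)
  have fin: "finite (colourings G1 q)" "finite (colourings G2 q)"
    using assms by (auto simp: fin_ttgraph_def finite_colourings)
  have respects: "(\<forall>u\<in>?V. \<forall>v\<in>?V. ?h u = ?h v \<longrightarrow> case_sum c1 c2 u = case_sum c1 c2 v) \<longleftrightarrow>
      c1 (finish G1) = c2 (start G2)" (is "?L c1 c2 \<longleftrightarrow> ?R c1 c2")
    for c1 :: "'a \<Rightarrow> nat" and c2 :: "'c \<Rightarrow> nat"
  proof
    assume L: "?L c1 c2"
    have "?h (Inl (finish G1)) = ?h (Inr (start G2))" by (simp add: merge_def)
    then show "?R c1 c2" using L terminals by (metis InlI InrI old.sum.simps(5,6))
  next
    assume R: "?R c1 c2"
    have "case_sum c1 c2 (?h u) = case_sum c1 c2 u" for u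
      using R by (simp add: merge_def)
    then show "?L c1 c2" by metis
  qed
  have range: "c (start G2) < q" if "c \<in> colourings G2 q" for c
    using that terminals by (auto simp: colourings_def)
  have "{(c1, c2) \<in> colourings G1 q \<times> colourings G2 q.
      ?L c1 c2 \<and> case_sum c1 c2 (Inl (start G1)) = i \<and> case_sum c1 c2 (Inr (finish G2)) = j}
    = (\<Union>k<q. terminal_colourings G1 q i k \<times> terminal_colourings G2 q k j)"
    using range by (auto simp: terminal_colourings_def respects)
  moreover have "card \<dots> = (\<Sum>k<q. card (terminal_colourings G1 q i k \<times> terminal_colourings G2 q k j))"
    by (rule card_UN_disjoint) (use fin in \<open>auto simp: terminal_colourings_def\<close>)
  ultimately show ?thesis
    using assms terminals
      card_terminal_colourings_glue[of G1 G2 "Inl (start G1)" "Inr (finish G2)" ?h q i j]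
    by (simp add: series_comp_def Let_def fin_ttgraph_def InlI InrI card_cartesian_product)
qed

section \<open>Interactions as pairs of polynomials\<close>

text \<open>
  A pair \<open>(a, b)\<close> records \<open>a = Z\<^sup>same / q\<close> and \<open>b = Z\<^sup>dif / (q (q - 1))\<close>, that is, the numbers of
  colourings that extend one given colouring of the terminals with equal, respectively different,
  colours. With this normalization \<open>y\<^sub>G = a / b\<close>. The rules say that \<open>a\<close> and \<open>b\<close> multiply under
  parallel composition; in the series rule one sums over the colour of the middle vertex.
\<close>

inductive interaction_polys :: "complex poly \<Rightarrow> complex poly \<Rightarrow> bool" where
  edge: "interaction_polys 0 1"
| parallel: "interaction_polys a b \<Longrightarrow> interaction_polys a' b' \<Longrightarrow> interaction_polys (a * a') (b * b')"
| series: "interaction_polys a b \<Longrightarrow> interaction_polys a' b' \<Longrightarrow>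
    interaction_polys (a * a' + [:-1, 1:] * (b * b')) (a * b' + b * a' + [:-2, 1:] * (b * b'))"

text \<open>
  The two polynomials are pinned down by their values at all natural numbers.
\<close>

definition counted_by :: "('v, 'e) ttgraph \<Rightarrow> complex poly \<Rightarrow> complex poly \<Rightarrow> bool" where
  "counted_by G a b \<longleftrightarrow> fin_ttgraph G \<and> (\<forall>q. \<forall>i<q. \<forall>j<q.
     of_nat (card (terminal_colourings G q i j)) =
       (if i = j then poly a (of_nat q) else poly b (of_nat q)))"

lemma counted_by_edge_graph: "counted_by edge_graph 0 1"
proof -
  have "fin_ttgraph edge_graph"
    by (simp add: fin_ttgraph_def fin_mgraph_def edge_graph_def)
  moreover have "terminal_colourings edge_graph q i j =
      (if i = j then {} else {\<lambda>x. if x = 0 then i else if x = 1 then j else undefined})"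
    if "i < q" "j < q" for q i j
    using that by (auto simp: terminal_colourings_def colourings_def edge_graph_def PiE_iff
        extensional_def fun_eq_iff)
  ultimately show ?thesis by (simp add: counted_by_def)
qed

lemma counted_by_iso: "tt_iso G H \<Longrightarrow> counted_by G a b \<Longrightarrow> counted_by H a b"
  by (simp add: counted_by_def fin_ttgraph_iso card_terminal_colourings_iso)

lemma counted_by_parallel:
  "counted_by G1 a b \<Longrightarrow> counted_by G2 a' b' \<Longrightarrow>
    counted_by (parallel_comp G1 G2) (a * a') (b * b')"
  by (simp add: counted_by_def fin_ttgraph_parallel card_terminal_colourings_parallel)

lemma counted_by_series:
  assumes "counted_by G1 a b" "counted_by G2 a' b'"
  shows "counted_by (series_comp G1 G2)
    (a * a' + [:-1, 1:] * (b * b')) (a * b' + b * a' + [:-2, 1:] * (b * b'))"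
proof -
  have fin: "fin_ttgraph G1" "fin_ttgraph G2" using assms by (auto simp: counted_by_def)
  have sum: "(\<Sum>k<q. (if i = k then x else y) * (if k = j then x' else y')) =
      (if i = j then x * x' + (of_nat q - 1) * (y * y')
       else x * y' + y * x' + (of_nat q - 2) * (y * y'))"
    if "i < q" "j < q" for q i j and x y x' y' :: complex
  proof -
    \<comment> \<open>Written as deviations from the constant \<open>y * y'\<close>, all but one term are supported on one \<open>k\<close>.\<close>
    have "(if i = k then x else y) * (if k = j then x' else y') =
        y * y' + (if k = i then (x - y) * y' else 0) + (if k = j then y * (x' - y') else 0) +
        (if k = i then if i = j then (x - y) * (x' - y') else 0 else 0)" for k
      by (auto simp: algebra_simps)
    then show ?thesis
      using that by (simp add: sum.distrib) (auto simp: algebra_simps)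
  qed
  have "of_nat (card (terminal_colourings (series_comp G1 G2) q i j)) =
      (\<Sum>k<q. (if i = k then poly a (of_nat q) else poly b (of_nat q)) *
             (if k = j then poly a' (of_nat q) else poly b' (of_nat q)))"
    if "i < q" "j < q" for q i j
    unfolding card_terminal_colourings_series[OF fin] of_nat_sum of_nat_mult
    using assms that by (intro sum.cong) (simp_all add: counted_by_def)
  then show ?thesis
    using fin by (simp add: counted_by_def fin_ttgraph_series sum algebra_simps)
qed

lemma poly_eq_of_nat:
  fixes p r :: "complex poly"
  assumes "\<And>n. poly p (of_nat n) = poly r (of_nat n)"
  shows "p = r"
proof (rule ccontr)
  assume "p \<noteq> r"
  then have "finite {x. poly (p - r) x = 0}" by (intro poly_roots_finite) simp
  moreover have "range of_nat \<subseteq> {x. poly (p - r) x = 0}" using assms by auto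
  ultimately have "finite (range (of_nat :: nat \<Rightarrow> complex))" by (rule rev_finite_subset)
  then show False using range_inj_infinite[OF inj_of_nat] by blast
qed

text \<open>
  Sort the colourings by the colours of the two terminals.
\<close>

lemma chrom_poly_counted_by:
  assumes "counted_by G a b"
  shows "chrom_poly G = [:0, 1:] * (a + [:-1, 1:] * b)"
proof (rule poly_eq_of_nat)
  fix q :: nat
  have fin: "fin_ttgraph G" "fin_mgraph G" using assms by (auto simp: counted_by_def fin_ttgraph_def)
  have "colourings G q = (\<Union>(i, j)\<in>{..<q} \<times> {..<q}. terminal_colourings G q i j)"
    using fin by (auto simp: terminal_colourings_def fin_ttgraph_def) (auto simp: colourings_def)
  moreover have "card \<dots> = (\<Sum>(i, j)\<in>{..<q} \<times> {..<q}. card (terminal_colourings G q i j))"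
    unfolding split_def
    by (rule card_UN_disjoint)
      (use finite_colourings[OF fin(2)] in \<open>auto simp: terminal_colourings_def\<close>)
  ultimately have "of_nat (card (colourings G q)) =
      (\<Sum>i<q. \<Sum>j<q. of_nat (card (terminal_colourings G q i j)) :: complex)"
    by (simp add: sum.cartesian_product split_def)
  also have "\<dots> = (\<Sum>i<q. \<Sum>j<q. if i = j then poly a (of_nat q) else poly b (of_nat q))"
    using assms by (intro sum.cong) (simp_all add: counted_by_def)
  also have "\<dots> = (\<Sum>i<q. \<Sum>j<q. poly b (of_nat q) +
      (if j = i then poly a (of_nat q) - poly b (of_nat q) else 0))"
    by (intro sum.cong) auto
  also have "\<dots> = poly ([:0, 1:] * (a + [:-1, 1:] * b)) (of_nat q)"
    by (simp add: sum.distrib algebra_simps)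
  finally show "poly (chrom_poly G) (of_nat q) = poly ([:0, 1:] * (a + [:-1, 1:] * b)) (of_nat q)"
    by (simp add: poly_chrom_poly_of_nat fin)
qed

lemma ex_nat_ttgraph_iso:
  fixes H :: "('v :: countable, 'e :: countable) ttgraph"
  shows "\<exists>G :: (nat, nat) ttgraph. tt_iso H G"
proof -
  define G where "G = \<lparr>verts = to_nat ` verts H, edges = to_nat ` edges H,
    ends = (\<lambda>n. map_uprod to_nat (ends H (from_nat n))),
    start = to_nat (start H), finish = to_nat (finish H)\<rparr>"
  have "tt_iso H G"
    unfolding tt_iso_def G_def
    by (intro exI[of _ to_nat]) (auto intro!: inj_on_imp_bij_betw)
  then show ?thesis ..
qed

lemma series_parallel_counted_by:
  assumes "G \<in> series_parallel"
  obtains a b where "interaction_polys a b" "counted_by G a b"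
  using assms
proof (induction arbitrary: thesis rule: series_parallel.induct)
  case (edge G)
  then show ?case using interaction_polys.edge counted_by_edge_graph counted_by_iso by blast
next
  case (parallel G1 G2 G)
  obtain a b where 1: "interaction_polys a b" "counted_by G1 a b" using parallel.IH(1) by blast
  obtain a' b' where 2: "interaction_polys a' b'" "counted_by G2 a' b'" using parallel.IH(2) by blast
  show ?case
    by (rule parallel.prems[OF interaction_polys.parallel[OF 1(1) 2(1)]
          counted_by_iso[OF parallel.hyps(3) counted_by_parallel[OF 1(2) 2(2)]]])
next
  case (series G1 G2 G)
  obtain a b where 1: "interaction_polys a b" "counted_by G1 a b" using series.IH(1) by blast
  obtain a' b' where 2: "interaction_polys a' b'" "counted_by G2 a' b'" using series.IH(2) by blast
  show ?case
    by (rule series.prems[OF interaction_polys.series[OF 1(1) 2(1)]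
          counted_by_iso[OF series.hyps(3) counted_by_series[OF 1(2) 2(2)]]])
qed

lemma interaction_polys_realised:
  assumes "interaction_polys a b"
  obtains G where "G \<in> series_parallel" "counted_by G a b"
  using assms
proof (induction arbitrary: thesis rule: interaction_polys.induct)
  case edge
  obtain G :: "(nat, nat) ttgraph" where "tt_iso edge_graph G" using ex_nat_ttgraph_iso by blast
  then show ?case
    using edge series_parallel.edge counted_by_iso counted_by_edge_graph by blast
next
  case (parallel a b a' b')
  obtain G1 where G1: "G1 \<in> series_parallel" "counted_by G1 a b" using parallel.IH(1) by blast
  obtain G2 where G2: "G2 \<in> series_parallel" "counted_by G2 a' b'" using parallel.IH(2) by blast
  obtain G :: "(nat, nat) ttgraph" where iso: "tt_iso (parallel_comp G1 G2) G"
    using ex_nat_ttgraph_iso by blast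
  show ?case
    by (rule parallel.prems[OF series_parallel.parallel[OF G1(1) G2(1) iso]
          counted_by_iso[OF iso counted_by_parallel[OF G1(2) G2(2)]]])
next
  case (series a b a' b')
  obtain G1 where G1: "G1 \<in> series_parallel" "counted_by G1 a b" using series.IH(1) by blast
  obtain G2 where G2: "G2 \<in> series_parallel" "counted_by G2 a' b'" using series.IH(2) by blast
  obtain G :: "(nat, nat) ttgraph" where iso: "tt_iso (series_comp G1 G2) G"
    using ex_nat_ttgraph_iso by blast
  show ?case
    by (rule series.prems[OF series_parallel.series[OF G1(1) G2(1) iso]
          counted_by_iso[OF iso counted_by_series[OF G1(2) G2(2)]]])
qed

lemma edge_interaction_counted_by:
  assumes "counted_by G a b"
  shows "edge_interaction G = to_fract a / to_fract b"
proof -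
  have "Z_dif G = [:0, 1:] * ([:-1, 1:] * b)"
    using chrom_poly_counted_by[OF counted_by_parallel[OF assms counted_by_edge_graph]]
    by (simp add: Z_dif_def)
  moreover from this have "Z_same G = [:0, 1:] * a"
    using chrom_poly_counted_by[OF assms] by (simp add: Z_same_def algebra_simps)
  moreover have "to_fract [:0, 1::complex:] \<noteq> 0" "to_fract [:-1, 1::complex:] \<noteq> 0"
    by simp_all
  ultimately show ?thesis
    by (simp add: edge_interaction_def ratio_def to_fract_mult del: mult_pCons_left)
qed

text \<open>
  The denominator in lowest terms divides every other denominator, so where some denominator does
  not vanish the value can be computed from it.
\<close>

lemma rat_value_quotient:
  assumes "poly b q \<noteq> 0"
  shows "rat_value (to_fract a / to_fract b) q = Some (poly a q / poly b q)"
proof -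
  obtain c d where cd: "quot_of_fract (to_fract a / to_fract b) = (c, d)" by fastforce
  have "b \<noteq> 0" using assms by auto
  have "d \<noteq> 0" using snd_quot_of_fract_nonzero[of "to_fract a / to_fract b"] cd by simp
  have "coprime c d" using coprime_quot_of_fract[of "to_fract a / to_fract b"] cd by simp
  have "Fract c d = Fract a b"
    using Fract_quot_of_fract[of "to_fract a / to_fract b"] cd by (simp add: Fract_conv_to_fract)
  then have eq: "c * b = a * d" using \<open>b \<noteq> 0\<close> \<open>d \<noteq> 0\<close> by (simp add: eq_fract)
  then have "d dvd b" using \<open>coprime c d\<close>
    by (metis coprime_commute coprime_dvd_mult_right_iff dvd_triv_right)
  then have "poly d q \<noteq> 0" using assms by (auto elim: dvdE)
  moreover have "poly c q * poly b q = poly a q * poly d q" using eq by (metis poly_mult)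
  ultimately show ?thesis
    using assms cd by (simp add: rat_value_def frac_eq_eq)
qed

section \<open>Interactions at negative real arguments\<close>

text \<open>
  For real \<open>r < 0\<close> the interval \<open>[0, 1)\<close> of interactions is preserved by both compositions. In the
  series case \<open>t t' + r - 1\<close> and \<open>t + t' + r - 2\<close> are both non-positive, and their difference is
  \<open>(1 - t) (1 - t') > 0\<close>. This rules out degenerate interactions: one that is constant in
  \<open>q\<close> has to lie in \<open>[0, 1)\<close>, and a virtual interaction is never constant.
\<close>

lemma interaction_polys_negative:
  assumes "interaction_polys a b" and "r < 0"
  shows "\<exists>t. 0 \<le> t \<and> t < 1 \<and> poly b (complex_of_real r) \<noteq> 0 \<and>
     poly a (of_real r) = of_real t * poly b (of_real r)"
  using assms(1)
proof induction
  case edge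
  show ?case by (intro exI[of _ 0]) simp
next
  case (parallel a b a' b')
  then obtain t t' where t: "0 \<le> t" "t < 1" "poly b (of_real r) \<noteq> 0" "poly a (of_real r) = of_real t * poly b (of_real r)"
    and t': "0 \<le> t'" "t' < 1" "poly b' (of_real r) \<noteq> 0" "poly a' (of_real r) = of_real t' * poly b' (of_real r)"
    by blast
  have "t * t' < 1" using t(1,2) t'(1,2) mult_left_le[of t' t] by simp
  then show ?case using t t' by (intro exI[of _ "t * t'"]) simp
next
  case (series a b a' b')
  then obtain t t' where t: "0 \<le> t" "t < 1" "poly b (of_real r) \<noteq> 0" "poly a (of_real r) = of_real t * poly b (of_real r)"
    and t': "0 \<le> t'" "t' < 1" "poly b' (of_real r) \<noteq> 0" "poly a' (of_real r) = of_real t' * poly b' (of_real r)"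
    by blast
  define N D where "N = t * t' + r - 1" and "D = t + t' + r - 2"
  have "t * t' \<le> 1" using t(1,2) t'(1,2) by (simp add: mult_le_one)
  then have N: "N \<le> 0" using \<open>r < 0\<close> by (simp add: N_def)
  have D: "D < 0" using t t' \<open>r < 0\<close> by (simp add: D_def)
  have "0 < (1 - t) * (1 - t')" using t t' by simp
  then have "D < N" by (simp add: N_def D_def algebra_simps)
  let ?B = "poly b (of_real r) * poly b' (of_real r)"
  have a: "poly (a * a' + [:-1, 1:] * (b * b')) (of_real r) = of_real N * ?B"
    using t t' by (simp add: N_def algebra_simps)
  have b: "poly (a * b' + b * a' + [:-2, 1:] * (b * b')) (of_real r) = of_real D * ?B"
    using t t' by (simp add: D_def algebra_simps)
  show ?case
  proof (intro exI[of _ "N / D"] conjI)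
    show "0 \<le> N / D" using N D by (simp add: divide_nonpos_neg)
    show "N / D < 1" using \<open>D < N\<close> D by (simp add: divide_less_eq)
  qed (use a b t t' D in \<open>simp_all del: poly_add poly_mult poly_pCons\<close>)
qed

lemma polys_eq_on_ball:
  fixes p r :: "complex poly"
  assumes "\<And>x. x \<in> ball z e \<Longrightarrow> poly p x = poly r x" "0 < e"
  shows "p = r"
proof (rule ccontr)
  assume "p \<noteq> r"
  then have "finite {x. poly (p - r) x = 0}" by (intro poly_roots_finite) simp
  moreover have "ball z e \<subseteq> {x. poly (p - r) x = 0}" using assms by auto
  ultimately have "finite (ball z e)" by (rule rev_finite_subset)
  then show False using uncountable_ball[OF \<open>0 < e\<close>, of z] by (simp add: countable_finite)
qed

lemma edge_interaction_not_const:
  assumes "interaction_polys a b" "a = smult c b"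
  shows "cmod c < 1"
proof -
  obtain t where t: "0 \<le> t" "t < 1" "poly b (of_real (-1)) \<noteq> 0"
      "poly a (of_real (-1)) = of_real t * poly b (of_real (-1))"
    using interaction_polys_negative[OF assms(1), of "-1"] by auto
  then have "c = of_real t" using assms(2) by simp
  then show ?thesis using t by simp
qed

text \<open>
  The inverse \<open>(a - b) / (a + (q - 1) b)\<close> of the virtual interaction equals \<open>(1 - t) / (1 - t - r)\<close>
  at \<open>r < 0\<close> for some \<open>t \<in> [0, 1)\<close>. This is positive, but smaller than \<open>- 1 / r\<close>.
\<close>

lemma virtual_interaction_not_const:
  assumes "interaction_polys a b"
  shows "a - b \<noteq> smult c (a + [:-1, 1:] * b)"
proof
  assume eq: "a - b = smult c (a + [:-1, 1:] * b)"
  have c: "\<exists>t. 0 \<le> t \<and> t < 1 \<and> of_real (1 - t) = c * of_real (1 - t - r)" if "r < 0" for r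
  proof -
    obtain t where t: "0 \<le> t" "t < 1" "poly b (of_real r) \<noteq> 0"
        "poly a (of_real r) = of_real t * poly b (of_real r)"
      using interaction_polys_negative[OF assms \<open>r < 0\<close>] by auto
    have "poly (a - b) (of_real r) = poly (smult c (a + [:-1, 1:] * b)) (of_real r)" using eq by simp
    then have "(of_real t - 1) * poly b (of_real r) = c * (of_real t + of_real r - 1) * poly b (of_real r)"
      using t by (simp add: algebra_simps)
    then have "of_real t - 1 = c * (of_real t + of_real r - 1)" using t by simp
    then have "of_real (1 - t) = c * of_real (1 - t - r)" by (simp add: algebra_simps)
    then show ?thesis using t by blast
  qed
  define k where "k = cmod c"
  have k: "\<exists>t. 0 \<le> t \<and> t < 1 \<and> 1 - t = k * (1 - t - r)" if "r < 0" for r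
  proof -
    obtain t where t: "0 \<le> t" "t < 1" "of_real (1 - t) = c * of_real (1 - t - r)"
      using c[OF \<open>r < 0\<close>] by blast
    have "cmod (of_real (1 - t)) = cmod (c * of_real (1 - t - r))" using t by simp
    then have "1 - t = k * (1 - t - r)" using t \<open>r < 0\<close> unfolding k_def norm_mult norm_of_real by simp
    then show ?thesis using t by blast
  qed
  have "k \<noteq> 0" using k[of "-1"] by auto
  then have "k > 0" by (simp add: k_def)
  \<comment> \<open>At this point the bound \<open>- 1 / r\<close> is \<open>k\<close> itself.\<close>
  then obtain t where t: "0 \<le> t" "t < 1" "1 - t = k * (1 - t - (- 1 / k))"
    using k[of "- 1 / k"] by auto
  then have "1 - t = k * (1 - t) + 1" using \<open>k > 0\<close> by (simp add: field_simps)
  moreover have "k * (1 - t) > 0" using t \<open>k > 0\<close> by simp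
  ultimately show False using t by simp
qed

section \<open>Powers under the two compositions\<close>

lemma interaction_polys_parallel_power:
  assumes "interaction_polys a b" "0 < n"
  shows "interaction_polys (a ^ n) (b ^ n)"
  using assms(2)
proof (induction n rule: nat_induct_non_zero)
  case (Suc n)
  then show ?case using interaction_polys.parallel[OF assms(1) Suc.IH] by simp
qed (use assms in simp)

text \<open>
  The virtual interaction is \<open>(a + (q - 1) b) / (a - b)\<close>, and its numerator and denominator both
  multiply under series composition.
\<close>

lemma interaction_polys_series_power:
  assumes "interaction_polys a b" "0 < n"
  shows "\<exists>c d. interaction_polys c d \<and> c - d = (a - b) ^ n \<and>
     c + [:-1, 1:] * d = (a + [:-1, 1:] * b) ^ n"
  using assms(2)
proof (induction n rule: nat_induct_non_zero)
  case 1
  show ?case using assms by auto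
next
  case (Suc n)
  then obtain c d where cd: "interaction_polys c d" "c - d = (a - b) ^ n"
     "c + [:-1, 1:] * d = (a + [:-1, 1:] * b) ^ n" by blast
  \<comment> \<open>As ring elements, the two linear factors are within reach of algebraic normalization.\<close>
  define X :: "complex poly" where "X = [:0, 1:]"
  have X: "[:-1, 1:] = X - 1" "[:-2, 1:] = X - 2" by (simp_all add: X_def one_pCons numeral_poly)
  let ?c = "a * c + [:-1, 1:] * (b * d)" and ?d = "a * d + b * c + [:-2, 1:] * (b * d)"
  have "?c - ?d = (a - b) * (c - d)" "?c + [:-1, 1:] * ?d = (a + [:-1, 1:] * b) * (c + [:-1, 1:] * d)"
    unfolding X by algebra+
  then show ?case
    using interaction_polys.series[OF assms(1) cd(1)] unfolding power_Suc cd(2,3) by blast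
qed

section \<open>Values of non-constant holomorphic functions\<close>

lemma ex_root_of_unity_near:
  assumes "open A" "w \<in> A" "cmod w = 1"
  shows "\<exists>z\<in>A. \<exists>n>0. z ^ n = 1"
proof -
  obtain \<theta> where w: "w = cis \<theta>" using assms(3) by (metis complex_norm_eq_1_exp_eq cis_conv_exp)
  have "open ((\<lambda>x. cis (2 * pi * x)) -` A)"
    using assms(1) by (intro open_vimage continuous_intros)
  moreover have "\<theta> / (2 * pi) \<in> (\<lambda>x. cis (2 * pi * x)) -` A" using assms(2) w by simp
  ultimately obtain e where "e > 0" and e: "\<And>x. \<bar>x - \<theta> / (2 * pi)\<bar> < e \<Longrightarrow> cis (2 * pi * x) \<in> A"
    by (force simp: open_real)
  obtain r where r: "r \<in> \<rat>" "\<theta> / (2 * pi) < r" "r < \<theta> / (2 * pi) + e"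
    using Rats_dense_in_real[of "\<theta> / (2 * pi)" "\<theta> / (2 * pi) + e"] \<open>e > 0\<close> by auto
  obtain m :: int and n :: int where mn: "n > 0" "r = of_int m / of_int n"
    using r(1) by (metis Rats_cases')
  have "cis (2 * pi * r) ^ nat n = cis (of_int m * (2 * pi))"
    unfolding Complex.DeMoivre using mn by (simp add: mult_ac)
  also have "\<dots> = 1" by (metis cis_multiple_2pi Ints_of_int mult.commute)
  finally show ?thesis
    using e[of r] r mn(1) by (intro bexI[of _ "cis (2 * pi * r)"] exI[of _ "nat n"]) auto
qed

text \<open>
  The points \<open>w\<close> near 0 with \<open>\<bar>1 + (x - 1) w\<bar> = \<bar>1 - w\<bar>\<close> form a curve through 0 whose tangent is the
  line \<open>Re (x w) = 0\<close>, because
  \<open>\<bar>1 + (x - 1) w\<bar>\<^sup>2 - \<bar>1 - w\<bar>\<^sup>2 = 2 Re (x w) + O(\<bar>w\<bar>\<^sup>2)\<close>.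
  The image of \<open>g\<close> contains a disc around \<open>g p\<close>, hence for large \<open>n\<close> an arc of angle \<open>2 \<pi> / n\<close> on the
  circle of radius \<open>\<bar>g p\<bar>\<close>. Over this arc \<open>g\<^sup>n\<close> runs around the whole small circle of radius
  \<open>\<bar>g p\<bar>\<^sup>n\<close>, and so it meets both sides of the curve.
\<close>

lemma powers_surround_bisector:
  fixes g :: "complex \<Rightarrow> complex"
  assumes hol: "g holomorphic_on ball p r" and r: "0 < r" and nc: "\<not> g constant_on ball p r"
    and gp: "g p \<noteq> 0" "cmod (g p) < 1" and p: "p \<noteq> 0"
  obtains n x x' where "0 < n" "x \<in> ball p r" "x' \<in> ball p r"
    "cmod (1 + (x - 1) * g x ^ n) < cmod (1 - g x ^ n)"
    "cmod (1 - g x' ^ n) < cmod (1 + (x' - 1) * g x' ^ n)"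
proof -
  \<comment> \<open>For \<open>x\<close> in the smaller ball, the directions of \<open>x\<close> and \<open>p\<close> are close enough for a fixed choice
    of \<open>w\<close>.\<close>
  define s where "s = min r (cmod p / 2)"
  have s: "0 < s" "s \<le> r" "s \<le> cmod p / 2" using r p by (auto simp: s_def)
  have "open (g ` ball p s)"
    by (rule open_mapping_thm[OF hol open_ball connected_ball open_ball _ nc]) (use s in auto)
  then obtain e where e: "0 < e" "ball (g p) e \<subseteq> g ` ball p s"
    using s(1) by (meson centre_in_ball image_eqI openE)
  \<comment> \<open>A bound for the quadratic error term, as \<open>\<bar>x - 1\<bar> \<le> 2 \<bar>p\<bar> + 1\<close> on the ball.\<close>
  define K where "K = (2 * cmod p + 1)\<^sup>2 + 1"
  have "(\<lambda>n. pi / real n) \<longlonglongrightarrow> 0" by (rule lim_const_over_n)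
  then have ev1: "\<forall>\<^sub>F n in sequentially. pi / real n < e"
    using e(1) by (rule order_tendstoD)
  have "(\<lambda>n. cmod (g p) ^ n) \<longlonglongrightarrow> 0" using gp(2) by (intro LIMSEQ_realpow_zero) auto
  moreover have "0 < cmod p / K" using p by (simp add: K_def add_nonneg_pos)
  ultimately have ev2: "\<forall>\<^sub>F n in sequentially. cmod (g p) ^ n < cmod p / K"
    by (rule order_tendstoD)
  have "\<forall>\<^sub>F n in sequentially. pi / real n < e \<and> cmod (g p) ^ n < cmod p / K \<and> 0 < n"
    using ev1 ev2 eventually_gt_at_top[of 0] by eventually_elim auto
  then obtain n where n: "pi / real n < e" "cmod (g p) ^ n < cmod p / K" "0 < n"
    by (metis (mono_tags, lifting) eventually_sequentially order_refl)
  define \<rho> where "\<rho> = cmod (g p) ^ n"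
  have \<rho>: "0 < \<rho>" using gp by (simp add: \<rho>_def)
  have small: "\<rho> * K < cmod p"
    using n(2) by (simp add: \<rho>_def K_def pos_less_divide_eq add_nonneg_pos)
  have hit: "\<exists>x\<in>ball p s. g x ^ n = W" if "cmod W = \<rho>" for W
  proof -
    define \<theta> where "\<theta> = Arg (W / g p ^ n)"
    define z where "z = g p * cis (\<theta> / n)"
    have "cmod (W / g p ^ n) = 1" using that gp by (simp add: norm_divide norm_power \<rho>_def)
    then have "cis \<theta> = W / g p ^ n" using \<theta>_def by (metis cis_Arg norm_zero sgn_eq zero_neq_one div_by_1 of_real_1)
    then have "z ^ n = W" using n(3) gp by (simp add: z_def power_mult_distrib Complex.DeMoivre)
    moreover have "z \<in> ball (g p) e"
    proof -
      have "cmod (z - g p) = cmod (g p) * cmod (cis (\<theta> / n) - 1)"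
        by (simp add: z_def norm_mult[symmetric] algebra_simps)
      also have "\<dots> \<le> 1 * cmod (cis (\<theta> / n) - 1)" using gp by (intro mult_right_mono) auto
      also have "\<dots> \<le> \<bar>\<theta> / n\<bar>"
        using dist_exp_i_1[of "\<theta> / n"] abs_sin_x_le_abs_x[of "\<theta> / n / 2"] by (simp add: cis_conv_exp)
      also have "\<dots> \<le> pi / n"
        using Arg_bounded[of "W / g p ^ n"] by (simp add: \<theta>_def abs_le_iff divide_right_mono)
      finally show ?thesis using n(1) by (simp add: dist_norm norm_minus_commute)
    qed
    ultimately show ?thesis using e(2) by auto
  qed
  have near: "cmod p / 2 \<le> Re (x * cnj p) / cmod p \<and> cmod (x - 1) ^ 2 \<le> (2 * cmod p + 1)\<^sup>2"
    if "x \<in> ball p s" for x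
  proof -
    have d: "cmod (x - p) \<le> cmod p / 2" using that s by (simp add: dist_norm norm_minus_commute)
    have "x * cnj p = (x - p) * cnj p + of_real ((cmod p)\<^sup>2)"
      by (simp add: complex_norm_square[symmetric] algebra_simps)
    then have "Re (x * cnj p) = Re ((x - p) * cnj p) + (cmod p)\<^sup>2"
      by (metis Re_complex_of_real plus_complex.sel(1))
    moreover have "\<bar>Re ((x - p) * cnj p)\<bar> \<le> cmod (x - p) * cmod p"
      using abs_Re_le_cmod[of "(x - p) * cnj p"] by (simp add: norm_mult)
    moreover have "cmod (x - p) * cmod p \<le> (cmod p / 2) * cmod p"
      using d by (intro mult_right_mono) auto
    ultimately have "(cmod p)\<^sup>2 / 2 \<le> Re (x * cnj p)" by (simp add: power2_eq_square)
    then have 1: "cmod p / 2 \<le> Re (x * cnj p) / cmod p"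
      using p by (simp add: field_simps power2_eq_square)
    have "cmod (x - 1) \<le> cmod (x - p) + cmod p + 1"
      using norm_triangle_ineq4[of "x - p + p" 1] norm_triangle_ineq[of "x - p" p] by simp
    then have "cmod (x - 1) \<le> 2 * cmod p + 1" using d by (simp add: field_simps) (smt (verit) norm_ge_zero)
    then show ?thesis using 1 by (simp add: power_mono)
  qed
  have diff: "(cmod (1 + (x - 1) * w))\<^sup>2 - (cmod (1 - w))\<^sup>2 =
      2 * Re (x * w) + (cmod w)\<^sup>2 * ((cmod (x - 1))\<^sup>2 - 1)" for x w
    unfolding cmod_power2 by (simp add: power2_eq_square) algebra
  have bound: "\<bar>(cmod w)\<^sup>2 * ((cmod (x - 1))\<^sup>2 - 1)\<bar> < \<rho> * cmod p"
    if "cmod w = \<rho>" "x \<in> ball p s" for x w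
  proof -
    have "\<bar>(cmod (x - 1))\<^sup>2 - 1\<bar> \<le> K" 
      using near[OF that(2)] zero_le_power2[of "cmod (x - 1)"] zero_le_power2[of "2 * cmod p + 1"]
      unfolding K_def abs_le_iff by linarith
    then have "(cmod w)\<^sup>2 * \<bar>(cmod (x - 1))\<^sup>2 - 1\<bar> \<le> \<rho>\<^sup>2 * K" using that by (simp add: mult_left_mono)
    also have "\<dots> < \<rho> * cmod p" using small \<rho> by (simp add: power2_eq_square)
    finally show ?thesis by (simp add: abs_mult)
  qed
  \<comment> \<open>The direction in which \<open>Re (p w)\<close> is largest; its opposite serves for the other side.\<close>
  define W where "W = of_real \<rho> * cnj p / of_real (cmod p)"
  have W: "cmod W = \<rho>" using \<rho> p by (simp add: W_def norm_mult norm_divide)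
  have Re: "Re (x * W) = \<rho> * (Re (x * cnj p) / cmod p)" for x
    by (simp add: W_def field_simps)
  have ReW: "\<rho> * cmod p \<le> 2 * Re (x * W)" if "x \<in> ball p s" for x
  proof -
    have "\<rho> * (cmod p / 2) \<le> Re (x * W)"
      unfolding Re using near[OF that] \<rho> by (intro mult_left_mono) auto
    then show ?thesis by linarith
  qed
  obtain x' where x': "x' \<in> ball p s" "g x' ^ n = W" using hit[of W] W by auto
  obtain x where x: "x \<in> ball p s" "g x ^ n = - W" using hit[of "- W"] W by auto
  have "(cmod (1 - W))\<^sup>2 < (cmod (1 + (x' - 1) * W))\<^sup>2"
    using diff[of x' W] bound[OF W x'(1)] ReW[OF x'(1)] by linarith
  then have 1: "cmod (1 - g x' ^ n) < cmod (1 + (x' - 1) * g x' ^ n)"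
    unfolding x'(2) by (rule power_less_imp_less_base) simp
  have "Re (x * - W) = - Re (x * W)" by (simp only: mult_minus_right uminus_complex.sel)
  moreover have "cmod (- W) = \<rho>" using W by simp
  ultimately have "(cmod (1 + (x - 1) * (- W)))\<^sup>2 < (cmod (1 - (- W)))\<^sup>2"
    using diff[of x "- W"] bound[of "- W" x] x(1) ReW[OF x(1)] by linarith
  then have 2: "cmod (1 + (x - 1) * g x ^ n) < cmod (1 - g x ^ n)"
    unfolding x(2) by (rule power_less_imp_less_base) simp
  show ?thesis
    using that[OF n(3) _ _ 2 1] x(1) x'(1) s(2) by auto
qed

section \<open>Interactions on a disc without chromatic zeros\<close>

text \<open>
  No \<open>a + (q - 1) b\<close> and no \<open>b\<close> has a zero in \<open>U\<close>. Multiplied by \<open>q\<close>, the first is the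
  chromatic polynomial of the graph; multiplied by \<open>q (q - 1)\<close>, the second is that of its parallel
  composition with an edge.
\<close>

definition zero_free :: "complex set \<Rightarrow> bool" where
  "zero_free U \<longleftrightarrow> 0 \<notin> U \<and> (\<forall>a b. interaction_polys a b \<longrightarrow>
     (\<forall>x\<in>U. poly b x \<noteq> 0 \<and> poly (a + [:-1, 1:] * b) x \<noteq> 0))"

text \<open>
  The inverse of the virtual interaction is the function to work with: unlike the virtual
  interaction itself it has no poles on a zero-free set.
\<close>

lemma virtual_quotient_not_constant_on:
  assumes "zero_free (ball z e)" "interaction_polys a b" "0 < r" "ball p r \<subseteq> ball z e"
  defines "g \<equiv> \<lambda>x. poly (a - b) x / poly (a + [:-1, 1:] * b) x"
  shows "g holomorphic_on ball p r" "\<not> g constant_on ball p r"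
proof -
  have nz: "poly (a + [:-1, 1:] * b) x \<noteq> 0" if "x \<in> ball p r" for x
    using assms that unfolding zero_free_def by blast
  then show "g holomorphic_on ball p r"
    unfolding g_def by (intro holomorphic_intros) auto
  show "\<not> g constant_on ball p r"
  proof
    assume "g constant_on ball p r"
    then obtain c where "\<And>x. x \<in> ball p r \<Longrightarrow> g x = c" by (auto simp: constant_on_def)
    then have "poly (a - b) x = poly (smult c (a + [:-1, 1:] * b)) x" if "x \<in> ball p r" for x
      using nz[OF that] that unfolding g_def poly_smult by (metis nonzero_divide_eq_eq)
    then have "a - b = smult c (a + [:-1, 1:] * b)" using \<open>0 < r\<close> by (rule polys_eq_on_ball)
    then show False using virtual_interaction_not_const assms(2) by blast
  qed
qed

text \<open>
  By the open mapping theorem a unimodular value yields a nearby argument where the virtual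
  interaction is an \<open>n\<close>-th root of unity. There the \<open>n\<close>-fold series power has virtual interaction 1,
  that is, \<open>b = 0\<close>.
\<close>

lemma virtual_interaction_not_unimodular:
  assumes "zero_free (ball z e)" "interaction_polys a b" "x \<in> ball z e"
  shows "cmod (poly (a - b) x) \<noteq> cmod (poly (a + [:-1, 1:] * b) x)"
proof
  let ?S = "a + [:-1, 1:] * b"
  assume eq: "cmod (poly (a - b) x) = cmod (poly ?S x)"
  define g where "g = (\<lambda>x. poly (a - b) x / poly ?S x)"
  have e: "0 < e" using assms(3) by (metis ball_eq_empty empty_iff not_le)
  have "open (g ` ball z e)"
    unfolding g_def
    by (rule open_mapping_thm[OF virtual_quotient_not_constant_on(1)[OF assms(1,2) e order_refl]
          open_ball connected_ball open_ball order_refl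
          virtual_quotient_not_constant_on(2)[OF assms(1,2) e order_refl]])
  moreover have "poly ?S x \<noteq> 0" using assms unfolding zero_free_def by blast
  then have "cmod (g x) = 1" using eq by (simp add: g_def norm_divide del: poly_add poly_mult poly_pCons poly_diff)
  ultimately obtain y n where y: "y \<in> ball z e" "0 < n" "g y ^ n = 1"
    using ex_root_of_unity_near[of "g ` ball z e" "g x"] assms(3) by blast
  obtain c d where cd: "interaction_polys c d" "c - d = (a - b) ^ n" "c + [:-1, 1:] * d = ?S ^ n"
    using interaction_polys_series_power[OF assms(2) y(2)] by blast
  have "poly ?S y \<noteq> 0" using assms(1,2) y(1) unfolding zero_free_def by blast
  then have "poly (a - b) y ^ n = poly ?S y ^ n"
    using y(3) by (simp add: g_def power_divide del: poly_add poly_mult poly_pCons poly_diff)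
  then have "poly (c - d) y = poly (c + [:-1, 1:] * d) y"
    unfolding cd poly_power .
  then have "y * poly d y = 0" by (simp add: algebra_simps)
  then show False using assms(1) cd(1) y(1) unfolding zero_free_def by auto
qed

lemma virtual_interaction_one_side:
  assumes "zero_free (ball z e)" "interaction_polys a b" "x \<in> ball z e" "y \<in> ball z e"
    and x: "cmod (poly (a - b) x) < cmod (poly (a + [:-1, 1:] * b) x)"
  shows "cmod (poly (a - b) y) < cmod (poly (a + [:-1, 1:] * b) y)"
proof (rule ccontr)
  define f where "f = (\<lambda>x. cmod (poly (a - b) x) - cmod (poly (a + [:-1, 1:] * b) x))"
  assume "\<not> ?thesis"
  then have "f x \<le> 0" "0 \<le> f y" using x by (simp_all add: f_def)
  moreover have "connected (f ` ball z e)"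
    unfolding f_def by (intro connected_continuous_image continuous_intros connected_ball)
  ultimately have "0 \<in> f ` ball z e"
    using connected_contains_Icc[of "f ` ball z e" "f x" "f y"] assms(3,4) by fastforce
  then show False
    using virtual_interaction_not_unimodular[OF assms(1,2)] by (auto simp: f_def)
qed

text \<open>
  If \<open>\<bar>y\<bar> > 1\<close> at \<open>p\<close>, take parallel powers. With \<open>g = 1 / y\<close> the inverse of the virtual interaction of
  the \<open>n\<close>-th one is \<open>(1 - g\<^sup>n) / (1 + (q - 1) g\<^sup>n)\<close>, which for suitable \<open>n\<close> has values of modulus
  below and above 1. By connectedness of the disc this is impossible.
\<close>

lemma edge_interaction_le_1:
  assumes "zero_free (ball z e)" "interaction_polys a b" "p \<in> ball z e"
  shows "cmod (poly a p) \<le> cmod (poly b p)"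
proof (rule ccontr)
  assume "\<not> ?thesis"
  then have lt: "cmod (poly b p) < cmod (poly a p)" by simp
  have bp: "poly b p \<noteq> 0" and p0: "p \<noteq> 0" using assms unfolding zero_free_def by auto
  have "open (ball z e \<inter> {x. poly a x \<noteq> 0})"
    by (intro open_Int open_ball open_Collect_neq continuous_intros)
  moreover have "p \<in> ball z e \<inter> {x. poly a x \<noteq> 0}" using assms(3) lt by auto
  ultimately obtain r where r: "0 < r" "ball p r \<subseteq> ball z e \<inter> {x. poly a x \<noteq> 0}"
    by (meson openE)
  define g where "g = (\<lambda>x. poly b x / poly a x)"
  have hol: "g holomorphic_on ball p r" unfolding g_def using r(2) by (intro holomorphic_intros) auto
  have nc: "\<not> g constant_on ball p r"
  proof
    assume "g constant_on ball p r"
    then obtain c where c: "\<And>x. x \<in> ball p r \<Longrightarrow> g x = c" by (auto simp: constant_on_def)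
    then have cp: "c = poly b p / poly a p" using r(1) by (auto simp: g_def)
    have "poly a x = poly (smult (1 / c) b) x" if "x \<in> ball p r" for x
    proof -
      have "poly b x = c * poly a x" using c[OF that] that r(2) by (auto simp: g_def field_simps)
      moreover have "c \<noteq> 0" using cp bp lt by auto
      ultimately show ?thesis by simp
    qed
    then have "a = smult (1 / c) b" using r(1) by (rule polys_eq_on_ball)
    then have "cmod (1 / c) < 1" using edge_interaction_not_const[OF assms(2)] by blast
    then show False using lt bp by (simp add: cp norm_divide divide_less_eq split: if_splits)
  qed
  have "g p \<noteq> 0" "cmod (g p) < 1" using lt bp by (auto simp: g_def norm_divide divide_less_eq)
  then obtain n x x' where n: "0 < n" and x: "x \<in> ball p r" "cmod (1 + (x - 1) * g x ^ n) < cmod (1 - g x ^ n)"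
    and x': "x' \<in> ball p r" "cmod (1 - g x' ^ n) < cmod (1 + (x' - 1) * g x' ^ n)"
    using powers_surround_bisector[OF hol r(1) nc _ _ p0] by metis
  have D: "cmod (poly (a ^ n - b ^ n) y) = cmod (poly a y) ^ n * cmod (1 - g y ^ n)"
    and S: "cmod (poly (a ^ n + [:-1, 1:] * b ^ n) y) = cmod (poly a y) ^ n * cmod (1 + (y - 1) * g y ^ n)"
    and pos: "0 < cmod (poly a y) ^ n" if "y \<in> ball p r" for y
  proof -
    have "poly a y \<noteq> 0" using that r(2) by auto
    then show "cmod (poly (a ^ n - b ^ n) y) = cmod (poly a y) ^ n * cmod (1 - g y ^ n)"
      "cmod (poly (a ^ n + [:-1, 1:] * b ^ n) y) = cmod (poly a y) ^ n * cmod (1 + (y - 1) * g y ^ n)"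
      "0 < cmod (poly a y) ^ n"
      unfolding norm_power[symmetric] norm_mult[symmetric] g_def
      by (simp_all add: power_divide field_simps)
  qed
  have "cmod (poly (a ^ n - b ^ n) x) < cmod (poly (a ^ n + [:-1, 1:] * b ^ n) x)"
  proof (rule virtual_interaction_one_side[OF assms(1) interaction_polys_parallel_power[OF assms(2) n]])
    show "x' \<in> ball z e" "x \<in> ball z e" using x x' r(2) by auto
    show "cmod (poly (a ^ n - b ^ n) x') < cmod (poly (a ^ n + [:-1, 1:] * b ^ n) x')"
      unfolding D[OF x'(1)] S[OF x'(1)] using x'(2) pos[OF x'(1)] by (rule mult_strict_left_mono)
  qed
  moreover have "cmod (poly (a ^ n + [:-1, 1:] * b ^ n) x) < cmod (poly (a ^ n - b ^ n) x)"
    unfolding D[OF x(1)] S[OF x(1)] using x(2) pos[OF x(1)] by (rule mult_strict_left_mono)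
  ultimately show False by simp
qed

text \<open>
  If the virtual interaction has modulus greater than 1, let \<open>g\<close> be its inverse. The interaction of
  the \<open>n\<close>-fold series power is \<open>(1 + (q - 1) g\<^sup>n) / (1 - g\<^sup>n)\<close>, and for suitable \<open>n\<close> this has modulus
  greater than 1 somewhere.
\<close>

lemma virtual_interaction_le_1:
  assumes "zero_free (ball z e)" "interaction_polys a b" "q \<in> ball z e"
  shows "cmod (poly (a + [:-1, 1:] * b) q) \<le> cmod (poly (a - b) q)"
proof (rule ccontr)
  let ?S = "a + [:-1, 1:] * b"
  assume "\<not> ?thesis"
  then have lt: "cmod (poly (a - b) q) < cmod (poly ?S q)" by simp
  define g where "g = (\<lambda>x. poly (a - b) x / poly ?S x)"
  have nz: "poly ?S x \<noteq> 0" if "x \<in> ball z e" for x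
    using assms(1,2) that unfolding zero_free_def by blast
  have e: "0 < e" using assms(3) by (metis ball_eq_empty empty_iff not_le)
  \<comment> \<open>If \<open>g q = 0\<close>, then \<open>q\<close> has to be replaced by a nearby point.\<close>
  have "open (g ` ball z e)"
    unfolding g_def
    by (rule open_mapping_thm[OF virtual_quotient_not_constant_on(1)[OF assms(1,2) e order_refl]
          open_ball connected_ball open_ball order_refl
          virtual_quotient_not_constant_on(2)[OF assms(1,2) e order_refl]])
  then have "open (g ` ball z e \<inter> ball 0 1)" by (intro open_Int open_ball)
  moreover have gq: "g q \<in> g ` ball z e \<inter> ball 0 1"
    using assms(3) lt nz[OF assms(3)]
    by (auto simp: g_def norm_divide divide_less_eq simp del: poly_add poly_mult poly_pCons poly_diff)
  ultimately obtain k where k: "0 < k" "ball (g q) k \<subseteq> g ` ball z e \<inter> ball 0 1" by (meson openE)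
  have "\<not> ball (g q) k \<subseteq> {0}"
    using uncountable_ball[OF k(1), of "g q"] by (meson countable_subset countable_finite finite.simps)
  then obtain w where w: "w \<in> ball (g q) k" "w \<noteq> 0" by blast
  then have "w \<in> g ` ball z e" "w \<in> ball 0 1" using k(2) by blast+
  then obtain p where p: "p \<in> ball z e" "g p \<noteq> 0" "cmod (g p) < 1" using w(2) by auto
  have p0: "p \<noteq> 0" using assms(1) p(1) unfolding zero_free_def by auto
  obtain r where r: "0 < r" "ball p r \<subseteq> ball z e" using p(1) by (meson open_ball openE)
  obtain n y where n: "0 < n" and y: "y \<in> ball p r" "cmod (1 - g y ^ n) < cmod (1 + (y - 1) * g y ^ n)"
    using powers_surround_bisector[OF virtual_quotient_not_constant_on(1)[OF assms(1,2) r] r(1)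
      virtual_quotient_not_constant_on(2)[OF assms(1,2) r]] p(2,3) p0 unfolding g_def by metis
  have yU: "y \<in> ball z e" using y(1) r(2) by auto
  obtain c d where cd: "interaction_polys c d" "c - d = (a - b) ^ n" "c + [:-1, 1:] * d = ?S ^ n"
    using interaction_polys_series_power[OF assms(2) n] by blast
  define D S where "D = poly (a - b) y" and "S = poly ?S y"
  have S: "S \<noteq> 0" using nz[OF yU] unfolding S_def .
  have g: "g y = D / S" by (simp only: g_def D_def S_def)
  have "poly (c - d) y = D ^ n" "poly (c + [:-1, 1:] * d) y = S ^ n"
    unfolding cd by (simp_all only: poly_power D_def S_def)
  then have cd': "poly c y - poly d y = D ^ n" "poly c y + (y - 1) * poly d y = S ^ n"
    by (simp_all add: algebra_simps)
  have "y * poly d y = S ^ n - D ^ n" "y * poly c y = (y - 1) * D ^ n + S ^ n"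
    unfolding cd'[symmetric] by (simp_all add: algebra_simps)
  then have d: "y * poly d y = S ^ n * (1 - g y ^ n)"
    and c: "y * poly c y = S ^ n * (1 + (y - 1) * g y ^ n)"
    using S by (simp_all add: g power_divide field_simps)
  have "cmod (y * poly d y) < cmod (y * poly c y)"
    unfolding d c norm_mult using y(2) S by (intro mult_strict_left_mono) (simp_all add: norm_power)
  then have "cmod (poly d y) < cmod (poly c y)"
    by (simp add: norm_mult mult_less_cancel_left)
  then show False using edge_interaction_le_1[OF assms(1) cd(1) yU] by simp
qed

text \<open>
  The polynomial \<open>b\<close> is covered because parallel composition with an edge turns \<open>(a, b)\<close> into \<open>(0, b)\<close>.
\<close>

lemma zero_freeI:
  assumes "\<And>x G. x \<in> U \<Longrightarrow> G \<in> series_parallel \<Longrightarrow> poly (chrom_poly G) x \<noteq> 0" "0 \<notin> U"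
  shows "zero_free U"
  unfolding zero_free_def
proof (intro conjI allI impI ballI)
  fix a b x assume ab: "interaction_polys a b" and x: "x \<in> U"
  have *: "poly (a' + [:-1, 1:] * b') x \<noteq> 0" if ab': "interaction_polys a' b'" for a' b'
  proof -
    obtain G where "G \<in> series_parallel" "counted_by G a' b'"
      using interaction_polys_realised[OF ab'] by blast
    then show ?thesis
      using assms(1)[OF x] chrom_poly_counted_by by (metis mult_zero_right poly_mult)
  qed
  show "poly (a + [:-1, 1:] * b) x \<noteq> 0" by (rule *[OF ab])
  show "poly b x \<noteq> 0"
    using *[OF interaction_polys.parallel[OF ab interaction_polys.edge]] by auto
qed (use assms(2) in simp)

theorem theorem5:
  fixes q0 :: complex
  assumes "q0 \<noteq> 0"
    and "(\<exists>y\<in>edge_interactions q0. sphere_abs y > 1) \<or>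
         (\<exists>y\<in>virtual_interactions q0. sphere_abs y > 1)"
  shows "\<forall>\<epsilon>>0. \<exists>q. dist q q0 < \<epsilon> \<and> (\<exists>G\<in>series_parallel. poly (chrom_poly G) q = 0)"
proof (rule ccontr)
  assume "\<not> ?thesis"
  then obtain \<epsilon> where "\<epsilon> > 0"
    and none: "\<And>q G. dist q q0 < \<epsilon> \<Longrightarrow> G \<in> series_parallel \<Longrightarrow> poly (chrom_poly G) q \<noteq> 0"
    by blast
  define e where "e = min \<epsilon> (cmod q0)"
  have zf: "zero_free (ball q0 e)"
    by (rule zero_freeI) (auto simp: e_def dist_commute dest: none)
  have q0: "q0 \<in> ball q0 e" using \<open>\<epsilon> > 0\<close> assms(1) by (simp add: e_def)
  have interaction: "\<exists>a b. interaction_polys a b \<and> poly b q0 \<noteq> 0 \<and> y = Some (poly a q0 / poly b q0)"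
    if "y \<in> edge_interactions q0" for y
  proof -
    obtain G where G: "G \<in> series_parallel" "y = rat_value (edge_interaction G) q0"
      using \<open>y \<in> edge_interactions q0\<close> unfolding edge_interactions_def by blast
    obtain a b where ab: "interaction_polys a b" "counted_by G a b"
      using series_parallel_counted_by[OF G(1)] by blast
    then have "poly b q0 \<noteq> 0" using zf q0 unfolding zero_free_def by blast
    then show ?thesis
      using ab G(2) by (auto simp: edge_interaction_counted_by rat_value_quotient)
  qed
  from assms(2) show False
  proof
    assume "\<exists>y\<in>edge_interactions q0. sphere_abs y > 1"
    then obtain a b where ab: "interaction_polys a b" "poly b q0 \<noteq> 0"
        "sphere_abs (Some (poly a q0 / poly b q0)) > 1"
      using interaction by metis
    then have "cmod (poly a q0) > cmod (poly b q0)"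
      by (simp add: norm_divide less_divide_eq)
    then show False using edge_interaction_le_1[OF zf ab(1) q0] by simp
  next
    assume "\<exists>y\<in>virtual_interactions q0. sphere_abs y > 1"
    then obtain a b where ab: "interaction_polys a b" "poly b q0 \<noteq> 0"
        and gt: "sphere_abs (moebius_f q0 (Some (poly a q0 / poly b q0))) > 1"
      unfolding virtual_interactions_def using interaction by (metis imageE)
    have le: "cmod (poly (a + [:-1, 1:] * b) q0) \<le> cmod (poly (a - b) q0)"
      by (rule virtual_interaction_le_1[OF zf ab(1) q0])
    have "poly (a + [:-1, 1:] * b) q0 \<noteq> 0" using zf q0 ab(1) unfolding zero_free_def by blast
    then have ne: "poly (a - b) q0 \<noteq> 0" using le by auto
    then have "moebius_f q0 (Some (poly a q0 / poly b q0)) =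
        Some (poly (a + [:-1, 1:] * b) q0 / poly (a - b) q0)"
      using ab(2) by (simp add: field_simps)
    then have "cmod (poly (a + [:-1, 1:] * b) q0) > cmod (poly (a - b) q0)"
      using gt ne by (simp add: norm_divide less_divide_eq del: poly_add poly_mult poly_pCons poly_diff moebius_f.simps)
    then show False using le by simp
  qed
qed

end
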